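(* Let $\mathfrak{g}$ be a Leibniz algebra. Then the following statements hold. (1) If $\mathfrak{g}$ is solvable, then it is quasi-Artinian. (2) If $\mathfrak{g}$ is hypercentral and quasi-Artinian, then $\mathfrak{g}$ is solvable.
   Context: A (left) Leibniz algebra is a vector space $\mathfrak{g}$ (of arbitrary dimension) over a field with a bilinear bracket satisfying $[x,[y,z]]=[[x,y],z]+[y,[x,z]]$ for all $x,y,z$. "Ideal" means two-sided ideal. For subspaces $A,B$, $[A,B]$ is the linear span of all $[a,b]$, $a\in A$, $b\in B$. The derived series is $\mathfrak{g}^{(0)}=\mathfrak{g}$, $\mathfrak{g}^{(n+1)}=[\mathfrak{g}^{(n)},\mathfrak{g}^{(n)}]$; $\mathfrak{g}$ is solvable if $\mathfrak{g}^{(n)}=0$ for some $n\in\mathbb{N}$. $\mathfrak{g}$ is left (resp. right) quasi-Artinian if for every descending chain of ideals $I_1\supseteq I_2\supseteq\cdots$ of $\mathfrak{g}$ there is $m\in\mathbb{N}$ such that $[\mathfrak{g}^{(m)},I_m]\subseteq I_n$ (resp. $[I_m,\mathfrak{g}^{(m)}]\subseteq I_n$) for all $n\in\mathbb{N}$; it is quasi-Artinian if it is both left and right quasi-Artinian. The center is $Z_{\mathfrak{g}}=\{x\in\mathfrak{g}:[x,y]=[y,x]=0\ \text{for all } y\in\mathfrak{g}\}$. The transfinite upper central series is defined by $\zeta_0(\mathfrak{g})=0$, $\zeta_1(\mathfrak{g})=Z_{\mathfrak{g}}$, $\zeta_{\alpha+1}(\mathfrak{g})/\zeta_\alpha(\mathfrak{g})=\zeta_1(\mathfrak{g}/\zeta_\alpha(\mathfrak{g}))$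 for every ordinal $\alpha$, and $\zeta_\rho(\mathfrak{g})=\bigcup_{\alpha<\rho}\zeta_\alpha(\mathfrak{g})$ for limit ordinals $\rho$. The hypercenter is $\zeta_*(\mathfrak{g})=\bigcup_\alpha\zeta_\alpha(\mathfrak{g})$, and $\mathfrak{g}$ is hypercentral if $\zeta_*(\mathfrak{g})=\mathfrak{g}$. *)

theory Defs
  imports Complex_Main
begin

text \<open>The center of the algebra with carrier \<open>A\<close>, zero \<open>z\<close> and bracket \<open>br\<close>.  Explicit carriers
  are needed because the notion is also used for quotient algebras, whose elements are cosets.\<close>

definition center_on :: "'a set \<Rightarrow> 'a \<Rightarrow> ('a \<Rightarrow> 'a \<Rightarrow> 'a) \<Rightarrow> 'a set" where
  "center_on A z br = {x \<in> A. \<forall>y\<in>A. br x y = z \<and> br y x = z}"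

text \<open>An ordinal is represented by a position \<open>a \<in> Field r\<close> of a well-order \<open>r\<close>, standing for the
  order type of \<open>underS r a\<close>.\<close>

definition immediate_pred :: "'o rel \<Rightarrow> 'o \<Rightarrow> 'o \<Rightarrow> bool" where
  "immediate_pred r b a \<longleftrightarrow> b \<in> underS r a \<and> (\<forall>c \<in> underS r a. (c, b) \<in> r)"

locale leibniz_algebra = vector_space scale
  for scale :: "'k::field \<Rightarrow> 'g::ab_group_add \<Rightarrow> 'g" +
  fixes bracket :: "'g \<Rightarrow> 'g \<Rightarrow> 'g"
  assumes linear_bracket_right: "Vector_Spaces.linear scale scale (\<lambda>y. bracket x y)"
    and linear_bracket_left: "Vector_Spaces.linear scale scale (\<lambda>x. bracket x y)"
    and leibniz: "bracket x (bracket y z) = bracket (bracket x y) z + bracket y (bracket x z)"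
begin

definition ideal :: "'g set \<Rightarrow> bool" where
  "ideal I \<longleftrightarrow> subspace I \<and> (\<forall>x. \<forall>y\<in>I. bracket x y \<in> I \<and> bracket y x \<in> I)"

definition bracket_span :: "'g set \<Rightarrow> 'g set \<Rightarrow> 'g set" where
  "bracket_span A B = span {bracket a b |a b. a \<in> A \<and> b \<in> B}"

primrec derived_series :: "nat \<Rightarrow> 'g set" where
  "derived_series 0 = UNIV"
| "derived_series (Suc n) = bracket_span (derived_series n) (derived_series n)"

definition solvable :: bool where
  "solvable \<longleftrightarrow> (\<exists>n. derived_series n = {0})"

text \<open>Only the values at indices \<open>n \<ge> 1\<close> of the sequence \<open>I\<close> are used.\<close>

definition descending_chain_of_ideals :: "(nat \<Rightarrow> 'g set) \<Rightarrow> bool" where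
  "descending_chain_of_ideals I \<longleftrightarrow> (\<forall>n\<ge>1. ideal (I n) \<and> I (Suc n) \<subseteq> I n)"

definition left_quasi_artinian :: bool where
  "left_quasi_artinian \<longleftrightarrow> (\<forall>I. descending_chain_of_ideals I \<longrightarrow>
     (\<exists>m\<ge>1. \<forall>n\<ge>1. bracket_span (derived_series m) (I m) \<subseteq> I n))"

definition right_quasi_artinian :: bool where
  "right_quasi_artinian \<longleftrightarrow> (\<forall>I. descending_chain_of_ideals I \<longrightarrow>
     (\<exists>m\<ge>1. \<forall>n\<ge>1. bracket_span (I m) (derived_series m) \<subseteq> I n))"

definition quasi_artinian :: bool where
  "quasi_artinian \<longleftrightarrow> left_quasi_artinian \<and> right_quasi_artinian"

definition center :: "'g set" where
  "center = center_on UNIV 0 bracket"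

definition cong_mod :: "'g set \<Rightarrow> 'g rel" where
  "cong_mod I = {(x, y). x - y \<in> I}"

definition quotient_bracket :: "'g set \<Rightarrow> 'g set \<Rightarrow> 'g set \<Rightarrow> 'g set" where
  "quotient_bracket I X Y = (\<Union>x\<in>X. \<Union>y\<in>Y. cong_mod I `` {bracket x y})"

definition quotient_center :: "'g set \<Rightarrow> 'g set set" where
  "quotient_center I = center_on (UNIV // cong_mod I) (cong_mod I `` {0}) (quotient_bracket I)"

text \<open>The subspace \<open>J\<close> with \<open>J / I\<close> equal to the center of the quotient by \<open>I\<close>.\<close>

definition next_center :: "'g set \<Rightarrow> 'g set" where
  "next_center I = {x. cong_mod I `` {x} \<in> quotient_center I}"

definition upper_central :: "'o rel \<Rightarrow> 'o \<Rightarrow> 'g set" where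
  "upper_central r = wo_rel.worec r (\<lambda>\<zeta> a.
     if underS r a = {} then {0}
     else if \<exists>b. immediate_pred r b a then next_center (\<zeta> (THE b. immediate_pred r b a))
     else (\<Union>b\<in>underS r a. \<zeta> b))"

text \<open>HOL has no type of all ordinals.  Well-orders whose elements have type \<open>'g set\<close>
  suffice, since the series is stationary before the order type of a well-order of the power set
  of the algebra is exhausted; \<open>upper_central_subset_hypercenter\<close> below shows that well-orders on other types add nothing.\<close>

definition hypercenter :: "'g set" where
  "hypercenter = \<Union>{upper_central r a |(r :: 'g set rel) a. Well_order r \<and> a \<in> Field r}"

definition hypercentral :: bool where
  "hypercentral \<longleftrightarrow> hypercenter = UNIV"


lemma bracket_simps [simp]:
  "bracket x 0 = 0" "bracket 0 x = 0"
  "bracket x (y + z) = bracket x y + bracket x z" "bracket (x + y) z = bracket x z + bracket y z"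
  "bracket x (y - z) = bracket x y - bracket x z" "bracket (x - y) z = bracket x z - bracket y z"
  "bracket x (scale c y) = scale c (bracket x y)" "bracket (scale c x) y = scale c (bracket x y)"
proof -
  have R: "module_hom scale scale (bracket x)" for x
    using linear_bracket_right unfolding Vector_Spaces.linear_def module_hom_iff by auto
  have L: "module_hom scale scale (\<lambda>x. bracket x y)" for y
    using linear_bracket_left unfolding Vector_Spaces.linear_def module_hom_iff by auto
  show "bracket x 0 = 0" "bracket 0 x = 0"
    "bracket x (y + z) = bracket x y + bracket x z" "bracket (x + y) z = bracket x z + bracket y z"
    "bracket x (y - z) = bracket x y - bracket x z" "bracket (x - y) z = bracket x z - bracket y z"
    "bracket x (scale c y) = scale c (bracket x y)" "bracket (scale c x) y = scale c (bracket x y)"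
    using module_hom.zero[OF R] module_hom.zero[OF L] module_hom.add[OF R] module_hom.add[OF L]
      module_hom.diff[OF R] module_hom.diff[OF L] module_hom.scale[OF R] module_hom.scale[OF L]
    by auto
qed

lemma ideal_zero: "ideal {0}"
  by (auto simp: ideal_def)

lemma equiv_cong_mod:
  assumes "ideal I" shows "equiv UNIV (cong_mod I)"
proof (rule equivI)
  have S: "subspace I" using assms by (simp add: ideal_def)
  show "refl_on UNIV (cong_mod I)"
    using subspace_0[OF S] by (auto simp: refl_on_def cong_mod_def)
  show "sym (cong_mod I)"
    using subspace_neg[OF S] by (fastforce simp: sym_def cong_mod_def)
  show "trans (cong_mod I)"
    using subspace_add[OF S] by (fastforce simp: trans_def cong_mod_def)
qed auto

lemma quotient_bracket_coset:
  assumes "ideal I"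
  shows "quotient_bracket I (cong_mod I `` {x}) (cong_mod I `` {y}) = cong_mod I `` {bracket x y}"
proof -
  have S: "subspace I" using assms by (simp add: ideal_def)
  have E: "equiv UNIV (cong_mod I)" by (rule equiv_cong_mod[OF assms])
  have *: "cong_mod I `` {bracket x' y'} = cong_mod I `` {bracket x y}"
    if "x - x' \<in> I" "y - y' \<in> I" for x' y'
  proof -
    have "bracket x y - bracket x' y' = bracket (x - x') y + bracket x' (y - y')" by simp
    also have "\<dots> \<in> I" using assms that unfolding ideal_def by (intro subspace_add[OF S]) blast+
    finally have "(bracket x y, bracket x' y') \<in> cong_mod I" by (simp add: cong_mod_def)
    then show ?thesis using equiv_class_eq[OF E] by metis
  qed
  have coset: "cong_mod I `` {u} = {u'. u - u' \<in> I}" for u by (auto simp: cong_mod_def)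
  have "x \<in> cong_mod I `` {x}" "y \<in> cong_mod I `` {y}" using subspace_0[OF S] by (simp_all add: coset)
  then have ne: "cong_mod I `` {x} \<noteq> {}" "cong_mod I `` {y} \<noteq> {}" by blast+
  have "quotient_bracket I (cong_mod I `` {x}) (cong_mod I `` {y}) =
    (\<Union>x'\<in>cong_mod I `` {x}. \<Union>y'\<in>cong_mod I `` {y}. cong_mod I `` {bracket x y})"
    unfolding quotient_bracket_def by (intro SUP_cong refl *) (simp_all add: coset)
  then show ?thesis using ne by simp
qed

lemma next_center_iff:
  assumes "ideal I"
  shows "x \<in> next_center I \<longleftrightarrow> (\<forall>y. bracket x y \<in> I \<and> bracket y x \<in> I)"
proof -
  have E: "equiv UNIV (cong_mod I)" by (rule equiv_cong_mod[OF assms])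
  have "cong_mod I `` {u} = cong_mod I `` {0} \<longleftrightarrow> u \<in> I" for u
    using eq_equiv_class_iff[OF E, of u 0] by (simp add: cong_mod_def)
  then show ?thesis
    by (auto simp: next_center_def quotient_center_def center_on_def quotient_def
        quotient_bracket_coset[OF assms])
qed

lemma next_center_zero: "next_center {0} = center"
  by (auto simp: next_center_iff[OF ideal_zero] center_def center_on_def)

lemma next_center_mono: "ideal I \<Longrightarrow> ideal J \<Longrightarrow> I \<subseteq> J \<Longrightarrow> next_center I \<subseteq> next_center J"
  by (simp add: next_center_iff subset_iff)

lemma subset_next_center: "ideal I \<Longrightarrow> I \<subseteq> next_center I"
  by (auto simp: next_center_iff) (auto simp: ideal_def)

lemma ideal_next_center:
  assumes "ideal I" shows "ideal (next_center I)"
proof -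
  have S: "subspace I" using assms by (simp add: ideal_def)
  have "subspace (next_center I)"
    by (rule subspaceI)
      (auto simp: next_center_iff[OF assms] subspace_0[OF S] subspace_add[OF S] subspace_scale[OF S])
  then show ?thesis
    using subset_next_center[OF assms] next_center_iff[OF assms] unfolding ideal_def by blast
qed

lemma immediate_pred_unique:
  assumes "Well_order r" "immediate_pred r b a" "immediate_pred r b' a" shows "b = b'"
  using assms by (auto simp: immediate_pred_def order_on_defs dest: antisymD)

lemma upper_central_unfold:
  assumes "Well_order r"
  shows "upper_central r a =
    (if underS r a = {} then {0}
     else if \<exists>b. immediate_pred r b a then next_center (upper_central r (THE b. immediate_pred r b a))
     else (\<Union>b\<in>underS r a. upper_central r b))"
proof -
  interpret W: wo_rel r using assms by (simp add: wo_rel_def)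
  have pred: "(THE b. immediate_pred r b a) \<in> underS r a" if "\<exists>b. immediate_pred r b a" for a
    using theI'[of "\<lambda>b. immediate_pred r b a"] that immediate_pred_unique[OF assms]
    by (metis immediate_pred_def)
  have "W.adm_wo (\<lambda>\<zeta> a. if underS r a = {} then {0}
     else if \<exists>b. immediate_pred r b a then next_center (\<zeta> (THE b. immediate_pred r b a))
     else (\<Union>b\<in>underS r a. \<zeta> b))"
    unfolding W.adm_wo_def using pred by auto
  from W.worec_fixpoint[OF this] show ?thesis
    unfolding upper_central_def by (rule fun_cong)
qed

lemma upper_central_zero:
  "Well_order r \<Longrightarrow> underS r a = {} \<Longrightarrow> upper_central r a = {0}"
  by (subst upper_central_unfold) auto

lemma upper_central_succ:
  assumes "Well_order r" "immediate_pred r b a"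
  shows "upper_central r a = next_center (upper_central r b)"
proof -
  have "(THE b. immediate_pred r b a) = b"
    using assms immediate_pred_unique by (intro the_equality) auto
  moreover have "underS r a \<noteq> {}" using assms by (auto simp: immediate_pred_def)
  ultimately show ?thesis using assms by (subst upper_central_unfold) auto
qed

lemma upper_central_limit:
  "Well_order r \<Longrightarrow> underS r a \<noteq> {} \<Longrightarrow> \<nexists>b. immediate_pred r b a \<Longrightarrow>
     upper_central r a = (\<Union>b\<in>underS r a. upper_central r b)"
  by (subst upper_central_unfold) auto

lemma underS_induct [consumes 1]:
  assumes "Well_order r" "\<And>a. (\<And>b. b \<in> underS r a \<Longrightarrow> P b) \<Longrightarrow> P a" shows "P a"
proof -
  interpret W: wo_rel r using assms by (simp add: wo_rel_def)
  show ?thesis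
    by (rule W.well_order_induct, rule assms(2)) (auto simp: underS_def)
qed

lemma underS_trans: "Well_order r \<Longrightarrow> b \<in> underS r a \<Longrightarrow> c \<in> underS r b \<Longrightarrow> c \<in> underS r a"
  by (auto simp: underS_def order_on_defs dest: transD antisymD)

lemma underS_total:
  "Well_order r \<Longrightarrow> b \<in> Field r \<Longrightarrow> c \<in> Field r \<Longrightarrow> b = c \<or> b \<in> underS r c \<or> c \<in> underS r b"
  by (auto simp: underS_def order_on_defs total_on_def)

lemma underS_Field': "b \<in> underS r a \<Longrightarrow> b \<in> Field r"
  by (auto simp: underS_def Field_def)

lemma upper_central_aux:
  assumes "Well_order r"
  shows "ideal (upper_central r a) \<and> (\<forall>b\<in>underS r a. next_center (upper_central r b) \<subseteq> upper_central r a)"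
  using assms
proof (induction a rule: underS_induct)
  case (1 a)
  have sub: "upper_central r c \<subseteq> upper_central r b" if "b \<in> underS r a" "c \<in> underS r b" for b c
    using 1[OF that(1)] 1[OF underS_trans[OF assms that]] that subset_next_center by blast
  consider "underS r a = {}" | b where "immediate_pred r b a"
    | "underS r a \<noteq> {}" "\<nexists>b. immediate_pred r b a" by blast
  then show ?case
  proof cases
    case 1 then show ?thesis using assms ideal_zero by (simp add: upper_central_zero)
  next
    case (2 b)
    have b: "b \<in> underS r a" using 2 by (simp add: immediate_pred_def)
    have eq: "upper_central r a = next_center (upper_central r b)" by (rule upper_central_succ[OF assms 2])
    have "next_center (upper_central r c) \<subseteq> upper_central r a" if c: "c \<in> underS r a" for c
    proof (cases "c = b")
      case False
      then have cb: "c \<in> underS r b" using 2 c by (auto simp: immediate_pred_def underS_def)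
      then have "next_center (upper_central r c) \<subseteq> upper_central r b" using 1[OF b] by blast
      then show ?thesis using eq subset_next_center 1[OF b] by blast
    qed (simp add: eq)
    then show ?thesis using eq 1[OF b] ideal_next_center by auto
  next
    case 3
    have eq: "upper_central r a = (\<Union>b\<in>underS r a. upper_central r b)"
      by (rule upper_central_limit[OF assms 3])
    have ub: "\<exists>d\<in>underS r a. upper_central r b \<subseteq> upper_central r d \<and> upper_central r c \<subseteq> upper_central r d"
      if "b \<in> underS r a" "c \<in> underS r a" for b c
      using underS_total[OF assms underS_Field'[OF that(1)] underS_Field'[OF that(2)]] sub that by blast
    have id: "ideal (upper_central r b)" if "b \<in> underS r a" for b using 1[OF that] by simp
    have S: "subspace (upper_central r b)" if "b \<in> underS r a" for b
      using id[OF that] by (simp add: ideal_def)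
    have "subspace (upper_central r a)"
    proof (rule subspaceI)
      show "0 \<in> upper_central r a" using S subspace_0 3(1) unfolding eq by auto
    next
      fix x y assume "x \<in> upper_central r a" "y \<in> upper_central r a"
      then obtain b c where "b \<in> underS r a" "c \<in> underS r a" "x \<in> upper_central r b" "y \<in> upper_central r c"
        unfolding eq by auto
      then obtain d where d: "d \<in> underS r a" "x \<in> upper_central r d" "y \<in> upper_central r d"
        using ub[of b c] by auto
      then show "x + y \<in> upper_central r a"
        using subspace_add[OF S[OF d(1)] d(2,3)] unfolding eq by auto
    next
      fix c x assume "x \<in> upper_central r a"
      then obtain b where b: "b \<in> underS r a" "x \<in> upper_central r b" unfolding eq by auto
      then show "scale c x \<in> upper_central r a"
        using subspace_scale[OF S[OF b(1)] b(2)] unfolding eq by auto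
    qed
    then have "ideal (upper_central r a)" using id unfolding ideal_def eq by auto
    moreover have "next_center (upper_central r b) \<subseteq> upper_central r a" if b: "b \<in> underS r a" for b
    proof -
      obtain c where c: "c \<in> underS r a" "(c, b) \<notin> r" using 3(2) b by (auto simp: immediate_pred_def)
      have "(b, b) \<in> r" using assms underS_Field'[OF b] by (auto simp: order_on_defs refl_on_def)
      then have "b \<in> underS r c"
        using underS_total[OF assms underS_Field'[OF b] underS_Field'[OF c(1)]] c(2)
        by (auto simp: underS_def)
      then show ?thesis using 1[OF c(1)] c(1) unfolding eq by blast
    qed
    ultimately show ?thesis by blast
  qed
qed

lemma ideal_upper_central: "Well_order r \<Longrightarrow> ideal (upper_central r a)"
  using upper_central_aux[of r a] by simp

lemma upper_central_stationary:
  obtains b :: "'g set" and r where "Well_order r" "b \<in> Field r"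
    "next_center (upper_central r b) = upper_central r b"
proof -
  obtain r :: "'g set rel" where "well_order_on UNIV r"
    using well_order_on[of "UNIV :: 'g set set"] by auto
  from well_order_on_Well_order[OF this] have r: "Well_order r" "Field r = UNIV" by blast+
  have "\<exists>b. next_center (upper_central r b) = upper_central r b"
  proof (rule ccontr)
    assume "\<not> ?thesis"
    then have "\<forall>b. \<exists>x. x \<in> next_center (upper_central r b) - upper_central r b"
      using subset_next_center[OF ideal_upper_central[OF r(1)]] by blast
    then obtain x where x: "\<And>b. x b \<in> next_center (upper_central r b) - upper_central r b"
      using choice[of "\<lambda>b x. x \<in> next_center (upper_central r b) - upper_central r b"] by blast
    have ne: "x b \<noteq> x c" if "b \<in> underS r c" for b c
    proof
      assume "x b = x c"
      then show False using upper_central_aux[OF r(1), of c] x[of b] x[of c] that by (metis DiffD1 DiffD2 subsetD)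
    qed
    have "inj x"
    proof (rule injI, rule ccontr)
      fix b c assume "x b = x c" "b \<noteq> c"
      then show False using underS_total[OF r(1), of b c] r(2) ne[of b c] ne[of c b] by auto
    qed
    then have "surj (inv x)" by (rule inj_imp_surj_inv)
    then show False using Cantors_theorem[of UNIV] by auto
  qed
  then obtain b where "next_center (upper_central r b) = upper_central r b" ..
  moreover have "b \<in> Field r" unfolding r(2) by (rule UNIV_I)
  ultimately show ?thesis using r(1) that by blast
qed

lemma upper_central_subset_hypercenter:
  fixes r :: "'o rel"
  assumes "Well_order r"
  shows "upper_central r a \<subseteq> hypercenter"
proof -
  obtain b :: "'g set" and s where s: "Well_order s" "b \<in> Field s"
    "next_center (upper_central s b) = upper_central s b" by (rule upper_central_stationary)
  have I: "ideal (upper_central s b)" using s(1) by (rule ideal_upper_central)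
  have "upper_central r a \<subseteq> upper_central s b"
    using assms
  proof (induction a rule: underS_induct)
    case (1 a)
    consider "underS r a = {}" | c where "immediate_pred r c a"
      | "underS r a \<noteq> {}" "\<nexists>b. immediate_pred r b a" by blast
    then show ?case
    proof cases
      case 1 then show ?thesis using assms I subspace_0 by (simp add: upper_central_zero ideal_def)
    next
      case (2 c)
      then have "upper_central r c \<subseteq> upper_central s b" using 1 by (simp add: immediate_pred_def)
      then show ?thesis
        using next_center_mono[OF ideal_upper_central[OF assms] I] s(3) upper_central_succ[OF assms 2] by metis
    next
      case 3 then show ?thesis using 1 upper_central_limit[OF assms 3] by auto
    qed
  qed
  also have "\<dots> \<subseteq> hypercenter" using s by (auto simp: hypercenter_def)
  finally show ?thesis .
qed

end

end

theory Submission
  imports Defs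
begin

text \<open>If the derived series reaches \<open>0\<close>, quasi-Artinianity is immediate.  Conversely, the derived
  series is itself a descending chain of ideals, so quasi-Artinianity makes it stabilise at a
  perfect \<open>P\<close>.  Transfinite induction shows that \<open>P\<close> annihilates every term of the upper central
  series on both sides (as in Gruen's lemma: \<open>[x, [y, z]]\<close> and \<open>[[y, z], x]\<close> expand by the Leibniz
  identity into brackets of \<open>P\<close> with an earlier term).  In a hypercentral algebra \<open>P\<close> therefore
  annihilates itself, and \<open>P = [P, P] = 0\<close>.\<close>

context leibniz_algebra
begin

lemma bracket_in_bracket_span: "a \<in> A \<Longrightarrow> b \<in> B \<Longrightarrow> bracket a b \<in> bracket_span A B"
  unfolding bracket_span_def by (rule span_base) blast

lemma bracket_span_least:
  assumes "subspace S" "\<And>a b. a \<in> A \<Longrightarrow> b \<in> B \<Longrightarrow> bracket a b \<in> S"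
  shows "bracket_span A B \<subseteq> S"
  unfolding bracket_span_def using assms by (intro span_minimal) auto

lemma subspace_bracket_span: "subspace (bracket_span A B)"
  by (simp add: bracket_span_def)

lemma bracket_span_zero [simp]: "bracket_span {0} B = {0}" "bracket_span A {0} = {0}"
proof -
  have "0 \<in> bracket_span A B" for A B
    by (rule subspace_0[OF subspace_bracket_span])
  then show "bracket_span {0} B = {0}" "bracket_span A {0} = {0}"
    using bracket_span_least[of "{0}" "{0}" B] bracket_span_least[of "{0}" A "{0}"] by auto
qed

lemma ideal_UNIV: "ideal UNIV"
  by (simp add: ideal_def)

text \<open>Left multiplication by \<open>x\<close> is a derivation, so it takes
  \<open>bracket a b\<close> to a sum of brackets of elements of \<open>I\<close>. Right
  multiplication is handled by solving the Leibniz identity for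
  \<open>bracket (bracket a b) x\<close>.\<close>

lemma ideal_bracket_span_self:
  assumes "ideal I" shows "ideal (bracket_span I I)"
proof -
  let ?J = "bracket_span I I"
  have S: "subspace ?J" by (rule subspace_bracket_span)
  have I: "bracket x a \<in> I" "bracket a x \<in> I" if "a \<in> I" for a x
    using assms that by (auto simp: ideal_def)
  \<comment> \<open>The elements that both multiplications by \<open>x\<close> send into
    \<open>?J\<close> form a subspace, so generators suffice.\<close>
  have "?J \<subseteq> {y. bracket x y \<in> ?J \<and> bracket y x \<in> ?J}" for x
  proof (rule bracket_span_least)
    show "subspace {y. bracket x y \<in> ?J \<and> bracket y x \<in> ?J}"
      by (rule subspaceI) (auto simp: subspace_0[OF S] subspace_add[OF S] subspace_scale[OF S])
  next
    fix a b assume ab: "a \<in> I" "b \<in> I"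
    have "bracket (bracket a b) x = bracket a (bracket b x) - bracket b (bracket a x)"
      using leibniz[of a b x] by (simp add: algebra_simps)
    then show "bracket a b \<in> {y. bracket x y \<in> ?J \<and> bracket y x \<in> ?J}"
      using ab I by (auto simp: leibniz[of x a b]
          intro!: subspace_add[OF S] subspace_diff[OF S] bracket_in_bracket_span)
  qed
  then show ?thesis using S unfolding ideal_def by blast
qed

lemma ideal_derived_series: "ideal (derived_series n)"
  by (induction n) (simp_all add: ideal_UNIV ideal_bracket_span_self)

lemma derived_series_Suc_subset: "derived_series (Suc n) \<subseteq> derived_series n"
  using ideal_derived_series[of n] unfolding derived_series.simps(2) ideal_def
  by (intro bracket_span_least) blast+

text \<open>This is the chain to which the quasi-Artinian condition will be applied.\<close>

lemma descending_chain_derived_series: "descending_chain_of_ideals derived_series"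
  unfolding descending_chain_of_ideals_def
  using ideal_derived_series derived_series_Suc_subset by blast

lemma solvable_imp_quasi_artinian:
  assumes solvable shows quasi_artinian
proof -
  obtain n where "derived_series n = {0}" using assms by (auto simp: solvable_def)
  \<comment> \<open>The index \<open>n\<close> may be 0, whereas the quasi-Artinian condition asks
    for one that is at least 1.\<close>
  then have m: "derived_series (Suc n) = {0}" by simp
  have "{0} \<subseteq> I k" if "descending_chain_of_ideals I" "k \<ge> 1" for I k
    using that subspace_0 by (auto simp: descending_chain_of_ideals_def ideal_def)
  then show ?thesis
    unfolding quasi_artinian_def left_quasi_artinian_def right_quasi_artinian_def
    by (auto intro!: exI[of _ "Suc n"] simp: m simp del: derived_series.simps)
qed

lemma perfect_annihilates_upper_central:
  assumes "Well_order r" and P: "P \<subseteq> bracket_span P P" and "x \<in> upper_central r a" "p \<in> P"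
  shows "bracket x p = 0 \<and> bracket p x = 0"
proof -
  have "\<forall>x\<in>upper_central r a. \<forall>p\<in>P. bracket x p = 0 \<and> bracket p x = 0"
    using assms(1)
  proof (induction a rule: underS_induct)
    case (1 a)
    consider "underS r a = {}" | b where "immediate_pred r b a"
      | "underS r a \<noteq> {}" "\<nexists>b. immediate_pred r b a" by blast
    then show ?case
    proof cases
      case 1 then show ?thesis using assms(1) by (simp add: upper_central_zero)
    next
      case (2 b)
      have IH: "bracket x p = 0" "bracket p x = 0" if "x \<in> upper_central r b" "p \<in> P" for x p
        using 1[of b] 2 that by (auto simp: immediate_pred_def)
      have "P \<subseteq> {p. bracket x p = 0 \<and> bracket p x = 0}" if "x \<in> upper_central r a" for x
      proof -
        have x: "bracket x y \<in> upper_central r b" "bracket y x \<in> upper_central r b" for y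
          using that upper_central_succ[OF assms(1) 2] next_center_iff[OF ideal_upper_central[OF assms(1)]]
          by auto
        have "bracket_span P P \<subseteq> {p. bracket x p = 0 \<and> bracket p x = 0}"
        proof (rule bracket_span_least)
          show "subspace {p. bracket x p = 0 \<and> bracket p x = 0}"
            by (rule subspaceI) auto
        next
          fix y z assume "y \<in> P" "z \<in> P"
          \<comment> \<open>In both expansions the inner bracket of \<open>x\<close> with
            \<open>y\<close> or \<open>z\<close> falls into the term at \<open>b\<close>, and the
            outer factor from \<open>P\<close> kills it by \<open>IH\<close>.\<close>
          then show "bracket y z \<in> {p. bracket x p = 0 \<and> bracket p x = 0}"
            using leibniz[of y z x] IH x by (simp add: leibniz[of x y z])
        qed
        then show ?thesis using P by blast
      qed
      then show ?thesis by blast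
    next
      case 3 then show ?thesis using 1 unfolding upper_central_limit[OF assms(1) 3] by blast
    qed
  qed
  then show ?thesis using assms(3,4) by blast
qed

lemma hypercentral_left_quasi_artinian_imp_solvable:
  assumes hypercentral left_quasi_artinian shows solvable
proof -
  obtain m where m: "\<forall>n\<ge>1. bracket_span (derived_series m) (derived_series m) \<subseteq> derived_series n"
    using assms(2) descending_chain_derived_series unfolding left_quasi_artinian_def by blast
  \<comment> \<open>The left side of \<open>m\<close> is the term at \<open>Suc m\<close>, not at
    \<open>m\<close>; it lies in the term at \<open>Suc (Suc m)\<close>, which is
    \<open>bracket_span P P\<close>.\<close>
  define P where "P = derived_series (Suc m)"
  have P: "P \<subseteq> bracket_span P P"
    using m[rule_format, of "Suc (Suc m)"] by (simp add: P_def)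
  have "bracket x p = 0" if "p \<in> P" for x p
  proof -
    have "x \<in> hypercenter" using assms(1) by (simp add: hypercentral_def)
    then obtain r :: "'g set rel" and a where r: "Well_order r" "x \<in> upper_central r a"
      unfolding hypercenter_def by blast
    show ?thesis
      using perfect_annihilates_upper_central[OF r(1) P r(2) that] by simp
  qed
  \<comment> \<open>Here \<open>x\<close> was arbitrary in the algebra, so it may be taken in
    \<open>P\<close>.\<close>
  then have "bracket_span P P \<subseteq> {0}" by (intro bracket_span_least) auto
  moreover have "0 \<in> bracket_span P P" by (rule subspace_0[OF subspace_bracket_span])
  ultimately have "derived_series (Suc (Suc m)) = {0}" by (auto simp: P_def)
  then show ?thesis unfolding solvable_def by blast
qed

end

theorem proposition3p4:
  fixes scale :: "'k::field \<Rightarrow> 'g::ab_group_add \<Rightarrow> 'g"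
    and bracket :: "'g \<Rightarrow> 'g \<Rightarrow> 'g"
  assumes "leibniz_algebra scale bracket"
  shows "(leibniz_algebra.solvable scale bracket \<longrightarrow>
            leibniz_algebra.quasi_artinian scale bracket) \<and>
         (leibniz_algebra.hypercentral bracket \<and>
          leibniz_algebra.quasi_artinian scale bracket \<longrightarrow>
            leibniz_algebra.solvable scale bracket)"
proof -
  interpret leibniz_algebra scale bracket by fact
  show ?thesis
    using solvable_imp_quasi_artinian hypercentral_left_quasi_artinian_imp_solvable
    by (auto simp: quasi_artinian_def)
qed

end
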